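(* Let $P$ be a finite interval order. Every redundant cycle inequality of the key graph $G_P$ (equivalently, of the length polyhedron $Q_P$) can be expressed as a non-negative integral linear combination of other cycle inequalities, i.e., of cycle inequalities not equivalent to it.
   Context: A finite partial order $P=([n],\prec)$ is an interval order if there are compact real intervals $I_x=[\ell_x,r_x]$ with $x\prec y$ iff $r_x<\ell_y$; write $x\parallel y$ if $x\ne y$ are incomparable. The canonical representation $[\ell_x,r_x]_{x\in[n]}$ of $P$ is the (unique) representation using the minimum number $m$ of distinct endpoints, placed at $0,\dots,m-1$. For $y\not\prec x$, the slack of $(x,y)$ there is $\ell_y-r_x-1$ if $x\prec y$, $r_y-\ell_x$ if $x\parallel y$, $r_x-\ell_x$ if $x=y$; slack-$0$ pairs are slack zero pairs, called cover pairs if $x\prec y$ and sharp pairs if $x\parallel y$. The key graph $G_P$ has vertex set $\{\rho_1,\dots,\rho_n\}$ and colored, weighted arcs (weights being linear inequalities in $\ell_1,\dots,\ell_n,\rho_1,\dots,\rho_n$): a blue arc $\rho_x\to\rho_y$ of weight $\langle\ell_x+\rho_x+1\le\ell_y\rangle$ for each slack zero cover pair; a red arc $\rho_x\to\rho_y$ of weight $\langle\ell_x\le\ell_y+\rho_y\rangle$ for each slack zero sharp pair; a red loop at $\rho_x$ of weight $\langle-\rho_x\le0\rangle$ for each slack zero pair $(x,x)$. For a directed cycle $C$ (loops included), the sum of its arc weights (added termwise, with cancellation) is its cycle inequality $\langle\gamma+\sum_{i\in A}\rho_i\le\sum_{j\in B}\rho_j\rangle$, where $\gamma$ is the number of blue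 arcs of $C$, and for consecutive arcs $\rho_x\to\rho_y\to\rho_z$ of $C$, $y\in A$ if both are blue and $y\in B$ if both are red. Inequalities are equivalent if they coincide after simplification. The length polyhedron $Q_P$ is the convex hull of the length vectors $(r_x-\ell_x)_x$ of integer-endpoint representations of $P$; it is known to be the set of $\rho\in\mathbb R^n$ satisfying all cycle inequalities. A cycle inequality $W$ is redundant if $W=\sum_{i=1}^t\alpha_iW_i$ for some cycle inequalities $W_i$ not equivalent to $W$ and rational $\alpha_i\ge0$. *)

theory Defs
  imports Complex_Main "Graph_Theory.Arc_Walk"
begin

section \<open>Interval orders and canonical representations\<close>

text \<open>An order on \<open>[n] = {1..n}\<close> is given by its strict relation; only the values of the
  relation, and of the endpoint functions below, at elements of \<open>{1..n}\<close> matter.\<close>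

definition finite_partial_order :: "nat \<Rightarrow> (nat \<Rightarrow> nat \<Rightarrow> bool) \<Rightarrow> bool" where
  "finite_partial_order n prec \<longleftrightarrow> irreflp_on {1..n} prec \<and> transp_on {1..n} prec"

definition interval_rep ::
  "nat \<Rightarrow> (nat \<Rightarrow> nat \<Rightarrow> bool) \<Rightarrow> (nat \<Rightarrow> 'a::linorder) \<Rightarrow> (nat \<Rightarrow> 'a) \<Rightarrow> bool" where
  "interval_rep n prec l r \<longleftrightarrow>
     (\<forall>x\<in>{1..n}. l x \<le> r x) \<and>
     (\<forall>x\<in>{1..n}. \<forall>y\<in>{1..n}. prec x y \<longleftrightarrow> r x < l y)"

definition interval_order :: "nat \<Rightarrow> (nat \<Rightarrow> nat \<Rightarrow> bool) \<Rightarrow> bool" where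
  "interval_order n prec \<longleftrightarrow>
     finite_partial_order n prec \<and> (\<exists>l r :: nat \<Rightarrow> real. interval_rep n prec l r)"

definition endpoints :: "nat \<Rightarrow> (nat \<Rightarrow> 'a) \<Rightarrow> (nat \<Rightarrow> 'a) \<Rightarrow> 'a set" where
  "endpoints n l r = l ` {1..n} \<union> r ` {1..n}"

definition min_endpoints :: "nat \<Rightarrow> (nat \<Rightarrow> nat \<Rightarrow> bool) \<Rightarrow> nat" where
  "min_endpoints n prec =
     (LEAST m. \<exists>l r :: nat \<Rightarrow> real. interval_rep n prec l r \<and> card (endpoints n l r) = m)"

definition canonical_rep ::
  "nat \<Rightarrow> (nat \<Rightarrow> nat \<Rightarrow> bool) \<Rightarrow> (nat \<Rightarrow> int) \<Rightarrow> (nat \<Rightarrow> int) \<Rightarrow> bool" where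
  "canonical_rep n prec l r \<longleftrightarrow>
     interval_rep n prec l r \<and> endpoints n l r = {0..<int (min_endpoints n prec)}"

section \<open>Slack\<close>

definition incomparable :: "(nat \<Rightarrow> nat \<Rightarrow> bool) \<Rightarrow> nat \<Rightarrow> nat \<Rightarrow> bool" where
  "incomparable prec x y \<longleftrightarrow> x \<noteq> y \<and> \<not> prec x y \<and> \<not> prec y x"

text \<open>Only meaningful when \<open>\<not> prec y x\<close>; the last branch is then the case of
  incomparable \<open>x\<close>, \<open>y\<close>.\<close>

definition slack ::
  "(nat \<Rightarrow> nat \<Rightarrow> bool) \<Rightarrow> (nat \<Rightarrow> int) \<Rightarrow> (nat \<Rightarrow> int) \<Rightarrow> nat \<Rightarrow> nat \<Rightarrow> int" where
  "slack prec l r x y =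
     (if prec x y then l y - r x - 1
      else if x = y then r x - l x
      else r y - l x)"

definition slack_zero_pair ::
  "nat \<Rightarrow> (nat \<Rightarrow> nat \<Rightarrow> bool) \<Rightarrow> (nat \<Rightarrow> int) \<Rightarrow> (nat \<Rightarrow> int) \<Rightarrow> nat \<Rightarrow> nat \<Rightarrow> bool" where
  "slack_zero_pair n prec l r x y \<longleftrightarrow>
     x \<in> {1..n} \<and> y \<in> {1..n} \<and> \<not> prec y x \<and> slack prec l r x y = 0"

definition cover_pair ::
  "nat \<Rightarrow> (nat \<Rightarrow> nat \<Rightarrow> bool) \<Rightarrow> (nat \<Rightarrow> int) \<Rightarrow> (nat \<Rightarrow> int) \<Rightarrow> nat \<Rightarrow> nat \<Rightarrow> bool" where
  "cover_pair n prec l r x y \<longleftrightarrow> slack_zero_pair n prec l r x y \<and> prec x y"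

definition sharp_pair ::
  "nat \<Rightarrow> (nat \<Rightarrow> nat \<Rightarrow> bool) \<Rightarrow> (nat \<Rightarrow> int) \<Rightarrow> (nat \<Rightarrow> int) \<Rightarrow> nat \<Rightarrow> nat \<Rightarrow> bool" where
  "sharp_pair n prec l r x y \<longleftrightarrow> slack_zero_pair n prec l r x y \<and> incomparable prec x y"

section \<open>The key graph\<close>

datatype key_arc = Blue nat nat | Red nat nat

fun key_tail :: "key_arc \<Rightarrow> nat" where
  "key_tail (Blue x y) = x"
| "key_tail (Red x y) = x"

fun key_head :: "key_arc \<Rightarrow> nat" where
  "key_head (Blue x y) = y"
| "key_head (Red x y) = y"

text \<open>The vertex \<open>\<rho>\<^sub>x\<close> is represented by its index \<open>x\<close>.\<close>

definition key_graph ::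
  "nat \<Rightarrow> (nat \<Rightarrow> nat \<Rightarrow> bool) \<Rightarrow> (nat \<Rightarrow> int) \<Rightarrow> (nat \<Rightarrow> int) \<Rightarrow> (nat, key_arc) pre_digraph" where
  "key_graph n prec l r =
     \<lparr> verts = {1..n},
       arcs = {Blue x y | x y. cover_pair n prec l r x y}
            \<union> {Red x y | x y. sharp_pair n prec l r x y}
            \<union> {Red x x | x. slack_zero_pair n prec l r x x},
       tail = key_tail,
       head = key_head \<rparr>"

section \<open>Linear inequalities and cycle inequalities\<close>

text \<open>The formal variables are \<open>\<l>\<^sub>x\<close> and \<open>\<rho>\<^sub>x\<close>; \<open>One\<close> stands for the constant term.\<close>

datatype monomial = One | Ell nat | Rho nat

text \<open>A linear inequality \<open>\<langle>lhs \<le> rhs\<rangle>\<close> is stored simplified: all terms are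
  moved to the left and collected, and the function gives the coefficients of
  \<open>lhs - rhs \<le> 0\<close>. Hence adding inequalities termwise with cancellation is pointwise addition
  of coefficients, and two inequalities coincide after simplification iff they are equal.\<close>

type_synonym lin_ineq = "monomial \<Rightarrow> int"

definition single :: "monomial \<Rightarrow> lin_ineq" where
  "single v = (\<lambda>u. if u = v then 1 else 0)"

definition lin_equivalent :: "lin_ineq \<Rightarrow> lin_ineq \<Rightarrow> bool" where
  "lin_equivalent V W \<longleftrightarrow> V = W"

text \<open>For a loop \<open>Red x x\<close> the terms in \<open>\<l>\<^sub>x\<close> cancel and \<open>\<langle>-\<rho>\<^sub>x \<le> 0\<rangle>\<close> is left.\<close>

fun arc_weight :: "key_arc \<Rightarrow> lin_ineq" where
  "arc_weight (Blue x y) =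
     (\<lambda>u. (single (Ell x) u + single (Rho x) u + single One u) - single (Ell y) u)"
| "arc_weight (Red x y) =
     (\<lambda>u. single (Ell x) u - (single (Ell y) u + single (Rho y) u))"

definition cycle_weight :: "key_arc list \<Rightarrow> lin_ineq" where
  "cycle_weight C = (\<lambda>u. \<Sum>a\<leftarrow>C. arc_weight a u)"

text \<open>Cycles are those of the library: non-empty closed walks without repeated vertices, loops and
  2-cycles included.\<close>

definition cycle_ineq ::
  "nat \<Rightarrow> (nat \<Rightarrow> nat \<Rightarrow> bool) \<Rightarrow> (nat \<Rightarrow> int) \<Rightarrow> (nat \<Rightarrow> int) \<Rightarrow> lin_ineq \<Rightarrow> bool" where
  "cycle_ineq n prec l r W \<longleftrightarrow>
     (\<exists>C. pre_digraph.cycle (key_graph n prec l r) C \<and> W = cycle_weight C)"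

definition redundant ::
  "nat \<Rightarrow> (nat \<Rightarrow> nat \<Rightarrow> bool) \<Rightarrow> (nat \<Rightarrow> int) \<Rightarrow> (nat \<Rightarrow> int) \<Rightarrow> lin_ineq \<Rightarrow> bool" where
  "redundant n prec l r W \<longleftrightarrow>
     (\<exists>(t::nat) (Ws :: nat \<Rightarrow> lin_ineq) (\<alpha> :: nat \<Rightarrow> rat).
        (\<forall>i\<in>{1..t}. cycle_ineq n prec l r (Ws i) \<and> \<not> lin_equivalent (Ws i) W \<and> 0 \<le> \<alpha> i) \<and>
        (\<forall>u. of_int (W u) = (\<Sum>i=1..t. \<alpha> i * of_int (Ws i u))))"

end

theory Submission
  imports Defs "HOL-Library.Multiset"
begin

text \<open>In a closed walk of the key graph, consecutive arcs at \<open>x\<close> of the same colour contribute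
  \<open>\<rho>\<^sub>x\<close> (blue) or \<open>-\<rho>\<^sub>x\<close> (red), and a change of colour contributes no variable. Weights add over arcs
  and every closed walk splits into cycles. The functional \<open>2\<gamma> - \<Sum>\<^sub>x w\<^sub>x\<close> counts arcs and is
  therefore positive on cycles, so it suffices to write \<open>W\<close> as a sum of at least two cycle
  inequalities; this is possible as soon as some closed walks with total weight \<open>W\<close> visit a vertex
  twice, or split into two non-empty parts.

  Let \<open>W = \<Sum>\<^sub>i \<alpha>\<^sub>i W\<^sub>i\<close> with cycles \<open>C\<close>, \<open>C\<^sub>i\<close>. The number of red arcs at a given endpoint is a linear
  function of the weight. If for some \<open>x\<close> the terms \<open>\<plusminus>\<rho>\<^sub>x\<close> cancel in the sum, comparing these numbers
  shows that \<open>C\<close> changes from blue to red at \<open>l\<^sub>x\<close> and from red to blue at \<open>r\<^sub>x\<close>, and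
  exchanging these turns for two visits to \<open>x\<close> keeps balance and weight. If nothing cancels, every pass
  of a \<open>C\<^sub>i\<close> with \<open>\<alpha>\<^sub>i > 0\<close> has an equivalent pass in \<open>C\<close>, so \<open>C\<^sub>i\<close> is a sum of cycles of passes of \<open>C\<close>;
  one of them has a weight other than \<open>W\<close> and can be split off \<open>C\<close>.\<close>

section \<open>Cycle decomposition of balanced multisets of arcs\<close>

text \<open>Elements with the same image are paired off one at a time. Applied with heads and tails,
  this assigns to every arc of a balanced multiset a successor, each arc being used once as a
  successor.\<close>

lemma image_mset_eq_matching:
  assumes "image_mset f A = image_mset g B"
  obtains M where "image_mset fst M = A" "image_mset snd M = B"
    "\<And>a b. (a, b) \<in># M \<Longrightarrow> f a = g b"
proof -
  have "\<exists>M. image_mset fst M = A \<and> image_mset snd M = B \<and> (\<forall>(a, b) \<in># M. f a = g b)"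
    using assms
  proof (induction A arbitrary: B)
    case empty
    then show ?case by auto
  next
    case (add a A)
    then have "f a \<in># image_mset g B" by (metis image_mset_add_mset union_single_eq_member)
    then obtain b where b: "b \<in># B" "g b = f a" by auto
    then obtain B' where B': "B = add_mset b B'" by (meson multi_member_split)
    with add.prems b have "image_mset f A = image_mset g B'" by simp
    from add.IH[OF this] obtain M where
      "image_mset fst M = A" "image_mset snd M = B'" "\<forall>(a, b) \<in># M. f a = g b" by blast
    with b B' show ?case by (intro exI[of _ "add_mset (a, b) M"]) auto
  qed
  with that show thesis by fast
qed

lemma (in pre_digraph) cas_image_mset:
  "cas u p v \<Longrightarrow> add_mset v (image_mset (tail G) (mset p)) = add_mset u (image_mset (head G) (mset p))"
proof (induction p arbitrary: u)
  case (Cons e p)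
  then have "add_mset v (image_mset (tail G) (mset p)) =
      add_mset (head G e) (image_mset (head G) (mset p))"
    by (simp add: cas.simps)
  with Cons.prems show ?case by (simp add: cas.simps add_mset_commute)
qed (simp add: cas.simps)

lemma (in pre_digraph) cycle_balanced:
  assumes "cycle p"
  shows "image_mset (tail G) (mset p) = image_mset (head G) (mset p)"
proof -
  from assms obtain u where "cas u p u" by (auto simp: cycle_def awalk_def)
  from cas_image_mset[OF this] show ?thesis by simp
qed

lemma (in wf_digraph) cycle_distinct_heads:
  assumes "cycle p"
  shows "distinct (map (head G) p)"
proof -
  from assms obtain u where u: "awalk u p u" "distinct (tl (awalk_verts u p))" "p \<noteq> []"
    by (auto simp: cycle_def)
  have "cas u p u" using u(1) by (auto simp: awalk_def)
  then have "tl (awalk_verts u p) = map (head G) p"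
    using awalk_verts_conv'[of u p u] u by auto
  with u show ?thesis by simp
qed

text \<open>Every head is again a tail, so walks inside \<open>S\<close> can be continued to any
  length; one with as many arcs as there are tails must repeat a vertex.\<close>

lemma (in wf_digraph) ex_cycle_in_arc_set:
  assumes "finite S" "S \<noteq> {}" "S \<subseteq> arcs G" "head G ` S \<subseteq> tail G ` S"
  obtains p where "cycle p" "set p \<subseteq> S"
proof -
  define H where "H = \<lparr>verts = tail G ` S, arcs = S, tail = tail G, head = head G\<rparr>"
  interpret H: wf_digraph H
    using assms(4) by unfold_locales (auto simp: H_def)
  have H_simps: "verts H = tail G ` S" "arcs H = S" "tail H = tail G" "head H = head G"
    by (simp_all add: H_def)
  have "\<forall>u \<in> tail G ` S. \<exists>p v. H.awalk u p v \<and> length p = k" for k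
  proof (induction k)
    case 0
    have "H.awalk u [] u" if "u \<in> tail G ` S" for u
      using that by (simp add: H.awalk_Nil_iff H_simps)
    then show ?case by fastforce
  next
    case (Suc k)
    show ?case
    proof
      fix u assume "u \<in> tail G ` S"
      then obtain e where e: "e \<in> S" "u = tail G e" by auto
      with assms(4) have "head G e \<in> tail G ` S" by auto
      with Suc obtain p v where "H.awalk (head G e) p v" "length p = k" by blast
      with e show "\<exists>p v. H.awalk u p v \<and> length p = Suc k"
        by (intro exI[of _ "e # p"] exI[of _ v]) (auto simp: H.awalk_Cons_iff H_simps)
    qed
  qed
  moreover obtain u where "u \<in> tail G ` S" using assms(2) by auto
  ultimately obtain p v where p: "H.awalk u p v" "length p = card (tail G ` S)" by blast
  have "\<not> distinct (H.awalk_verts u p)"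
  proof
    assume "distinct (H.awalk_verts u p)"
    then have "length (H.awalk_verts u p) = card (set (H.awalk_verts u p))"
      by (simp add: distinct_card)
    also have "\<dots> \<le> card (tail G ` S)"
    proof (rule card_mono)
      show "finite (tail G ` S)" using assms(1) by simp
      show "set (H.awalk_verts u p) \<subseteq> tail G ` S" using p(1) unfolding H.awalk_conv H_simps by blast
    qed
    finally show False using p(2) by (simp add: H.length_awalk_verts)
  qed
  with p(1) obtain c where "H.closed_w c" by (rule H.awalk_cyc_decompE')
  from H.closed_w_imp_cycle[OF this] obtain c where c: "H.cycle c" ..
  have cas: "H.cas x p y = cas x p y" for x p y
    by (induction p arbitrary: x) (simp_all add: H_simps H.cas.simps cas.simps)
  have vs: "H.awalk_verts x p = awalk_verts x p" for x p
    by (induction p arbitrary: x) (simp_all add: H_simps H.awalk_verts.simps awalk_verts.simps)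
  have "cycle c" "set c \<subseteq> S"
    using c assms(3) unfolding H.cycle_def cycle_def H.awalk_def awalk_def cas vs
    by (force simp: H_simps)+
  with that show thesis by blast
qed

lemma mset_subset_eq_of_distinct:
  assumes "distinct xs" "set xs \<subseteq> set_mset M"
  shows "mset xs \<subseteq># M"
  using assms subset_imp_msubset_mset_set[of "set xs" "set_mset M"] mset_set_set_mset_msubset[of M]
  by (metis finite_set_mset mset_set_set subset_mset.order_trans)

lemma member_le_sum_list_mset: "xs \<in> set xss \<Longrightarrow> mset xs \<subseteq># (\<Sum>ys\<leftarrow>xss. mset ys)"
  by (induction xss) (auto intro: subset_mset.add_increasing)

text \<open>Balance makes the sets of heads and tails equal, which yields a cycle. It repeats no
  arc, so it can be subtracted from \<open>M\<close>, and the rest is balanced and smaller.\<close>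

lemma (in wf_digraph) balanced_eq_sum_cycles:
  assumes "set_mset M \<subseteq> arcs G" "image_mset (tail G) M = image_mset (head G) M"
  shows "\<exists>Cs. (\<forall>C \<in> set Cs. cycle C) \<and> M = (\<Sum>C\<leftarrow>Cs. mset C)"
  using assms
proof (induction "size M" arbitrary: M rule: less_induct)
  case less
  show ?case
  proof (cases "M = {#}")
    case True
    then show ?thesis by (intro exI[of _ "[]"]) auto
  next
    case False
    have "head G ` set_mset M = tail G ` set_mset M"
      using less.prems(2) by (metis set_image_mset)
    then obtain C where C: "cycle C" "set C \<subseteq> set_mset M"
      using ex_cycle_in_arc_set[of "set_mset M"] less.prems(1) False
      by (metis finite_set_mset set_mset_eq_empty_iff subset_refl)
    have "distinct C" using cycle_distinct_heads[OF C(1)] by (simp add: distinct_map)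
    then have sub: "mset C \<subseteq># M" using C(2) by (rule mset_subset_eq_of_distinct)
    have ne: "C \<noteq> []" using C(1) by (auto simp: cycle_def)
    let ?M = "M - mset C"
    have "size ?M = size M - length C" "length C \<le> size M"
      using size_mset_mono[OF sub] by (simp_all add: size_Diff_submset[OF sub])
    with ne have "size ?M < size M" by (metis diff_less length_greater_0_conv less_le_trans)
    moreover have "set_mset ?M \<subseteq> arcs G" using less.prems(1) by (meson in_diffD subset_iff)
    moreover have "image_mset (tail G) ?M = image_mset (head G) ?M"
      using less.prems(2) cycle_balanced[OF C(1)] by (simp add: image_mset_Diff[OF sub])
    ultimately obtain Cs where "\<forall>C \<in> set Cs. cycle C" "?M = (\<Sum>C\<leftarrow>Cs. mset C)"
      using less.hyps by blast
    with C(1) sub show ?thesis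
      by (intro exI[of _ "C # Cs"]) (auto, metis subset_mset.add_diff_inverse)
  qed
qed

section \<open>Passes and linear functionals\<close>

definition total_weight :: "('a \<Rightarrow> lin_ineq) \<Rightarrow> 'a multiset \<Rightarrow> lin_ineq" where
  "total_weight f M = (\<lambda>u. \<Sum>m\<in>#M. f m u)"

lemma cycle_weight_eq_total_weight: "cycle_weight C = total_weight arc_weight (mset C)"
  by (simp add: cycle_weight_def total_weight_def flip: sum_mset_sum_list)

text \<open>A pass \<open>(x, i, j)\<close> records one visit of a closed walk to the vertex \<open>x\<close>: it enters by a blue
  arc iff \<open>i\<close> holds, and leaves by a blue arc iff \<open>j\<close> holds. The weight of an arc is split
  between the passes at its two ends.\<close>

type_synonym pass = "nat \<times> bool \<times> bool"

definition in_weight :: "nat \<Rightarrow> bool \<Rightarrow> lin_ineq" where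
  "in_weight x blue u = - single (Ell x) u - (if blue then 0 else single (Rho x) u)"

definition out_weight :: "nat \<Rightarrow> bool \<Rightarrow> lin_ineq" where
  "out_weight x blue u = single (Ell x) u + (if blue then single (Rho x) u + single One u else 0)"

fun pass_weight :: "pass \<Rightarrow> lin_ineq" where
  "pass_weight (x, i, j) u = in_weight x i u + out_weight x j u"

fun is_blue :: "key_arc \<Rightarrow> bool" where
  "is_blue (Blue x y) = True"
| "is_blue (Red x y) = False"

lemma arc_weight_eq:
  "arc_weight a u = in_weight (key_head a) (is_blue a) u + out_weight (key_tail a) (is_blue a) u"
  by (cases a) (auto simp: in_weight_def out_weight_def)

text \<open>The variables \<open>\<l>\<^sub>x\<close> are ignored, as they cancel in the weight of every pass.\<close>

definition evaluate :: "nat \<Rightarrow> int \<Rightarrow> (nat \<Rightarrow> int) \<Rightarrow> lin_ineq \<Rightarrow> int" where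
  "evaluate n c q V = c * V One + (\<Sum>x\<in>{1..n}. q x * V (Rho x))"

lemma evaluate_total_weight: "evaluate n c q (total_weight f M) = (\<Sum>m\<in>#M. evaluate n c q (f m))"
  by (induction M) (simp_all add: total_weight_def evaluate_def algebra_simps sum.distrib)

lemma evaluate_sum_list:
  "evaluate n c q (\<lambda>u. \<Sum>x\<leftarrow>xs. f x u) = (\<Sum>x\<leftarrow>xs. evaluate n c q (f x))"
  by (induction xs) (simp_all add: evaluate_def algebra_simps sum.distrib)

lemma evaluate_rat_combination:
  fixes \<alpha> :: "'i \<Rightarrow> rat"
  assumes "\<And>u. of_int (V u) = (\<Sum>i\<in>I. \<alpha> i * of_int (Vs i u))"
  shows "of_int (evaluate n c q V) = (\<Sum>i\<in>I. \<alpha> i * of_int (evaluate n c q (Vs i)))"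
proof -
  have "of_int (evaluate n c q V) =
      (\<Sum>i\<in>I. \<alpha> i * (of_int c * of_int (Vs i One))) +
      (\<Sum>x\<in>{1..n}. \<Sum>i\<in>I. \<alpha> i * (of_int (q x) * of_int (Vs i (Rho x))))"
    by (simp add: evaluate_def assms sum_distrib_left mult.left_commute)
  also have "\<dots> = (\<Sum>i\<in>I. \<alpha> i * of_int (evaluate n c q (Vs i)))"
    by (subst sum.swap) (simp add: evaluate_def sum_distrib_left sum.distrib algebra_simps)
  finally show ?thesis .
qed

lemma evaluate_pass_weight:
  assumes "x \<in> {1..n}"
  shows "evaluate n c q (pass_weight (x, i, j)) =
    (if j then q x + c else 0) - (if i then 0 else q x)"
proof -
  have "(\<Sum>y\<in>{1..n}. q y * pass_weight (x, i, j) (Rho y)) =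
      (\<Sum>y\<in>{1..n}. if y = x then (if j then q x else 0) - (if i then 0 else q x) else 0)"
    by (intro sum.cong) (auto simp: in_weight_def out_weight_def single_def)
  also have "\<dots> = (if j then q x else 0) - (if i then 0 else q x)"
    using assms by simp
  finally show ?thesis
    by (simp add: evaluate_def in_weight_def out_weight_def single_def)
qed

section \<open>Counting passes and turns\<close>

lemma total_weight_pass_Rho:
  "total_weight pass_weight P (Rho x) =
    int (count P (x, True, True)) - int (count P (x, False, False))"
proof (induction P)
  case (add q P)
  obtain y i j where "q = (y, i, j)" by (cases q)
  with add show ?case by (auto simp: total_weight_def in_weight_def out_weight_def single_def)
qed (simp add: total_weight_def)

text \<open>Read \<open>S\<close> and \<open>T i\<close> as numbers of turns and \<open>c\<close>,
  \<open>b i\<close> as numbers of red-red passes at the vertices sharing an endpoint. The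
  differences between the combined \<open>b\<close> and \<open>c\<close> are non-negative and add up
  to what \<open>S\<close> exceeds the combined \<open>T\<close> by, so each single difference is at
  most that excess.\<close>

lemma turn_bound:
  fixes \<alpha> :: "'i \<Rightarrow> rat" and T :: "'i \<Rightarrow> nat" and b :: "'i \<Rightarrow> 'a \<Rightarrow> nat"
  assumes "finite X" "x \<in> X"
    and "of_nat (S + (\<Sum>y\<in>X. c y)) = (\<Sum>i\<in>I. \<alpha> i * of_nat (T i + (\<Sum>y\<in>X. b i y)))"
    and "\<And>y. y \<in> X \<Longrightarrow> of_nat (c y) \<le> (\<Sum>i\<in>I. \<alpha> i * of_nat (b i y))"
  shows "(\<Sum>i\<in>I. \<alpha> i * of_nat (T i)) + ((\<Sum>i\<in>I. \<alpha> i * of_nat (b i x)) - of_nat (c x))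
    \<le> of_nat S"
proof -
  have "of_nat S + (\<Sum>y\<in>X. of_nat (c y)) =
      (\<Sum>i\<in>I. \<alpha> i * of_nat (T i)) + (\<Sum>i\<in>I. \<Sum>y\<in>X. \<alpha> i * of_nat (b i y))"
    using assms(3) by (simp add: sum.distrib algebra_simps sum_distrib_left)
  also have "(\<Sum>i\<in>I. \<Sum>y\<in>X. \<alpha> i * of_nat (b i y)) = (\<Sum>y\<in>X. \<Sum>i\<in>I. \<alpha> i * of_nat (b i y))"
    by (rule sum.swap)
  finally have "of_nat S = (\<Sum>i\<in>I. \<alpha> i * of_nat (T i)) +
      (\<Sum>y\<in>X. (\<Sum>i\<in>I. \<alpha> i * of_nat (b i y)) - of_nat (c y))"
    by (simp add: sum_subtractf)
  moreover have "(\<Sum>i\<in>I. \<alpha> i * of_nat (b i x)) - of_nat (c x) \<le>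
      (\<Sum>y\<in>X. (\<Sum>i\<in>I. \<alpha> i * of_nat (b i y)) - of_nat (c y))"
    by (rule member_le_sum[OF assms(2)]) (use assms in auto)
  ultimately show ?thesis by simp
qed

lemma count_image_mset_eq_sum:
  assumes "finite B" "\<And>m. m \<in># P \<Longrightarrow> f m = v \<longleftrightarrow> m \<in> B"
  shows "count (image_mset f P) v = (\<Sum>m\<in>B. count P m)"
  unfolding count_image_mset'
  by (rule sum.mono_neutral_left) (use assms in \<open>auto simp: count_eq_zero_iff\<close>)

lemma count_mset_le_1_of_distinct: "distinct xs \<Longrightarrow> count (mset xs) x \<le> 1"
  by (metis distinct_count_atmost_1 le_refl zero_le)

lemma count_image_fst_ge:
  "count P (x, True, True) + count P (x, False, False) \<le> count (image_mset fst P) x"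
proof (induction P)
  case (add q P)
  obtain y i j where "q = (y, i, j)" by (cases q)
  with add show ?case by (cases i; cases j; cases "x = y") simp_all
qed simp

section \<open>Closed walks in the key graph\<close>

locale interval_representation =
  fixes n :: nat and prec :: "nat \<Rightarrow> nat \<Rightarrow> bool" and l r :: "nat \<Rightarrow> int"
  assumes rep: "interval_rep n prec l r"
begin

abbreviation "G \<equiv> key_graph n prec l r"

text \<open>The order is determined by the endpoints, so each slack condition becomes one equation
  between endpoints. The red loops are the case \<open>x = y\<close> of
  \<open>l x = r y\<close>.\<close>

lemma arcs_key_graph:
  "arcs G = {Blue x y | x y. x \<in> {1..n} \<and> y \<in> {1..n} \<and> l y = r x + 1}
          \<union> {Red x y | x y. x \<in> {1..n} \<and> y \<in> {1..n} \<and> l x = r y}"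
proof -
  have ord: "l x \<le> r x" if "x \<in> {1..n}" for x
    using rep that by (auto simp: interval_rep_def)
  have prec: "prec x y \<longleftrightarrow> r x < l y" if "x \<in> {1..n}" "y \<in> {1..n}" for x y
    using rep that by (auto simp: interval_rep_def)
  have "cover_pair n prec l r x y \<longleftrightarrow> x \<in> {1..n} \<and> y \<in> {1..n} \<and> l y = r x + 1" for x y
    using ord[of x] ord[of y]
    by (auto simp: cover_pair_def slack_zero_pair_def slack_def prec simp del: atLeastAtMost_iff)
  then have "cover_pair n prec l r = (\<lambda>x y. x \<in> {1..n} \<and> y \<in> {1..n} \<and> l y = r x + 1)"
    by blast
  moreover have "sharp_pair n prec l r x y \<or> x = y \<and> slack_zero_pair n prec l r x x \<longleftrightarrow>
      x \<in> {1..n} \<and> y \<in> {1..n} \<and> l x = r y" for x y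
    using ord[of x] ord[of y]
    by (auto simp: sharp_pair_def slack_zero_pair_def slack_def incomparable_def prec
        simp del: atLeastAtMost_iff)
  then have "{Red x y | x y. sharp_pair n prec l r x y} \<union> {Red x x | x. slack_zero_pair n prec l r x x} =
      {Red x y | x y. x \<in> {1..n} \<and> y \<in> {1..n} \<and> l x = r y}"
    by blast
  ultimately show ?thesis by (simp add: key_graph_def Un_assoc)
qed

lemma tail_key_graph [simp]: "tail G = key_tail"
  and head_key_graph [simp]: "head G = key_head"
  by (simp_all add: key_graph_def)

sublocale key: wf_digraph G
  by unfold_locales (auto simp: arcs_key_graph, auto simp: key_graph_def)

text \<open>A blue arc \<open>x \<rightarrow> y\<close> exists iff \<open>l y - 1 = r x\<close>, a red one iff \<open>r y = l x\<close>. So two passes can be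
  consecutive iff the colour and this number agree, and passes become the arcs of a second digraph
  whose vertices are the pairs of a colour and a number.\<close>

fun pass_tail :: "pass \<Rightarrow> bool \<times> int" where
  "pass_tail (x, i, j) = (i, if i then l x - 1 else r x)"

fun pass_head :: "pass \<Rightarrow> bool \<times> int" where
  "pass_head (x, i, j) = (j, if j then r x else l x)"

definition pass_graph :: "(bool \<times> int, pass) pre_digraph" where
  "pass_graph = \<lparr>verts = UNIV, arcs = {1..n} \<times> UNIV, tail = pass_tail, head = pass_head\<rparr>"

lemma pass_graph_simps [simp]:
  "arcs pass_graph = {1..n} \<times> UNIV" "tail pass_graph = pass_tail" "head pass_graph = pass_head"
  by (simp_all add: pass_graph_def)

sublocale pass: wf_digraph pass_graph
  by unfold_locales (auto simp: pass_graph_def)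

definition balanced_passes :: "pass multiset \<Rightarrow> bool" where
  "balanced_passes P \<longleftrightarrow>
     set_mset P \<subseteq> {1..n} \<times> UNIV \<and> image_mset pass_tail P = image_mset pass_head P"

section \<open>Translation between arcs and passes\<close>

text \<open>Each arc is matched with a successor leaving its head; such a pair of arcs is a
  pass.\<close>

lemma balanced_passes_of_arcs:
  assumes "set_mset M \<subseteq> arcs G" "image_mset key_tail M = image_mset key_head M"
  obtains P where "balanced_passes P" "image_mset fst P = image_mset key_tail M"
    "total_weight pass_weight P = total_weight arc_weight M"
proof -
  obtain N where N: "image_mset fst N = M" "image_mset snd N = M"
    "\<And>a b. (a, b) \<in># N \<Longrightarrow> key_head a = key_tail b"
    using image_mset_eq_matching assms(2) by metis
  define P where "P = image_mset (\<lambda>(a, b). (key_tail b, is_blue a, is_blue b)) N"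
  \<comment> \<open>The vertex of the pass graph that an arc stands for: its colour and the number
    shared by its two ends. It is the tail of the pass at the head of the arc and the head of the
    pass at its tail.\<close>
  define pos where "pos a = (is_blue a, if is_blue a then r (key_tail a) else l (key_tail a))" for a
  have arc: "fst q \<in># M" "snd q \<in># M" "key_head (fst q) = key_tail (snd q)" if "q \<in># N" for q
    using that N(3)[of "fst q" "snd q"] by (auto simp flip: N(1))
      (metis N(1,2) image_eqI set_image_mset)+
  have arcG: "fst q \<in> arcs G" "snd q \<in> arcs G" if "q \<in># N" for q
    using arc[OF that] assms(1) by auto
  have "image_mset pass_tail P = image_mset pos (image_mset fst N)"
    unfolding P_def image_mset.compositionality
    by (intro image_mset_cong, use arc(3) arcG in \<open>fastforce simp: arcs_key_graph pos_def\<close>)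
  moreover have "image_mset pass_head P = image_mset pos (image_mset snd N)"
    unfolding P_def image_mset.compositionality
    by (intro image_mset_cong) (auto simp: pos_def)
  moreover have "set_mset P \<subseteq> {1..n} \<times> UNIV"
    using arcG(2) by (fastforce simp: P_def arcs_key_graph)
  ultimately have "balanced_passes P" by (simp add: N balanced_passes_def)
  moreover have "image_mset fst P = image_mset key_tail (image_mset snd N)"
    by (simp add: P_def image_mset.compositionality comp_def case_prod_beta)
  moreover have "total_weight pass_weight P = total_weight arc_weight M"
  proof
    fix u
    have "total_weight pass_weight P u =
        (\<Sum>q\<in>#N. in_weight (key_head (fst q)) (is_blue (fst q)) u +
          out_weight (key_tail (snd q)) (is_blue (snd q)) u)"
      unfolding total_weight_def P_def image_mset.compositionality
      by (intro arg_cong[of _ _ sum_mset] image_mset_cong) (auto simp: N(3))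
    also have "\<dots> = (\<Sum>a\<in>#image_mset fst N. in_weight (key_head a) (is_blue a) u) +
        (\<Sum>a\<in>#image_mset snd N. out_weight (key_tail a) (is_blue a) u)"
      by (simp add: sum_mset.distrib image_mset.compositionality comp_def)
    also have "\<dots> = total_weight arc_weight M u"
      by (simp add: N total_weight_def arc_weight_eq sum_mset.distrib)
    finally show "total_weight pass_weight P u = total_weight arc_weight M u" .
  qed
  ultimately show thesis using that N(2) by metis
qed

text \<open>Conversely, two passes meeting at a vertex of the pass graph agree in colour and number,
  which is exactly what an arc of that colour between their key graph vertices requires.\<close>

lemma balanced_arcs_of_passes:
  assumes "balanced_passes P"
  obtains M where "set_mset M \<subseteq> arcs G" "image_mset key_tail M = image_mset key_head M"
    "image_mset key_tail M = image_mset fst P" "total_weight arc_weight M = total_weight pass_weight P"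
proof -
  obtain N where N: "image_mset fst N = P" "image_mset snd N = P"
    "\<And>p q. (p, q) \<in># N \<Longrightarrow> pass_head p = pass_tail q"
    using image_mset_eq_matching assms unfolding balanced_passes_def by metis
  define f :: "pass \<times> pass \<Rightarrow> key_arc" where
    "f = (\<lambda>((x, i, j), (y, i', j')). if j then Blue x y else Red x y)"
  define M where "M = image_mset f N"
  have f: "key_tail (f (p, q)) = fst p" "key_head (f (p, q)) = fst q"
    "is_blue (f (p, q)) = snd (snd p)" for p q
    by (auto simp: f_def split: prod.splits)
  have pass: "fst p \<in> {1..n}" "fst q \<in> {1..n}" "pass_head p = pass_tail q" if "(p, q) \<in># N" for p q
  proof -
    have "p \<in># P" "q \<in># P" using that N(1,2) by (metis fst_conv snd_conv image_eqI set_image_mset)+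
    then show "fst p \<in> {1..n}" "fst q \<in> {1..n}"
      using assms by (auto simp: balanced_passes_def)
  qed (rule N(3)[OF that])
  have "set_mset M \<subseteq> arcs G"
  proof
    fix a assume "a \<in># M"
    then obtain p q where pq: "(p, q) \<in># N" "a = f (p, q)" by (auto simp: M_def)
    obtain x i j y i' j' where "p = (x, i, j)" "q = (y, i', j')" by (cases p, cases q) auto
    with pass[OF pq(1)] pq(2) show "a \<in> arcs G" 
      by (auto simp: f_def arcs_key_graph split: if_splits)
  qed
  moreover have tl: "image_mset key_tail M = image_mset fst (image_mset fst N)"
    unfolding M_def image_mset.compositionality by (intro image_mset_cong) (auto simp: f)
  moreover have "image_mset key_head M = image_mset fst (image_mset snd N)"
    unfolding M_def image_mset.compositionality by (intro image_mset_cong) (auto simp: f)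
  moreover have "total_weight arc_weight M = total_weight pass_weight P"
  proof
    fix u
    have "total_weight arc_weight M u =
        (\<Sum>q\<in>#N. out_weight (fst (fst q)) (snd (snd (fst q))) u +
          in_weight (fst (snd q)) (fst (snd (snd q))) u)"
      unfolding total_weight_def M_def image_mset.compositionality
    proof (intro arg_cong[of _ _ sum_mset] image_mset_cong)
      fix a assume "a \<in># N"
      moreover obtain x i j y i' j' where "a = ((x, i, j), (y, i', j'))" by (metis surj_pair)
      ultimately show "((\<lambda>m. arc_weight m u) \<circ> f) a =
          out_weight (fst (fst a)) (snd (snd (fst a))) u + in_weight (fst (snd a)) (fst (snd (snd a))) u"
        using N(3)[of "fst a" "snd a"] by (simp add: arc_weight_eq f)
    qed
    also have "\<dots> = (\<Sum>p\<in>#image_mset fst N. out_weight (fst p) (snd (snd p)) u) +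
        (\<Sum>p\<in>#image_mset snd N. in_weight (fst p) (fst (snd p)) u)"
      by (simp add: sum_mset.distrib image_mset.compositionality comp_def)
    also have "\<dots> = (\<Sum>p\<in>#P. pass_weight p u)"
      unfolding N sum_mset.distrib[symmetric]
      by (intro arg_cong[of _ _ sum_mset] image_mset_cong) auto
    finally show "total_weight arc_weight M u = total_weight pass_weight P u"
      by (simp add: total_weight_def)
  qed
  ultimately show thesis using that N by metis
qed

lemma cycle_passes:
  assumes "key.cycle C"
  obtains P where "balanced_passes P" "P \<noteq> {#}" "\<And>x. count (image_mset fst P) x \<le> 1"
    "total_weight pass_weight P = cycle_weight C"
proof -
  have C: "set_mset (mset C) \<subseteq> arcs G" "C \<noteq> []"
    using assms by (auto simp: key.cycle_def key.awalk_def)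
  have bal: "image_mset key_tail (mset C) = image_mset key_head (mset C)"
    using key.cycle_balanced[OF assms] by simp
  obtain P where P: "balanced_passes P" "image_mset fst P = image_mset key_tail (mset C)"
    "total_weight pass_weight P = total_weight arc_weight (mset C)"
    using balanced_passes_of_arcs[OF C(1) bal] by blast
  have "distinct (map key_head C)" using key.cycle_distinct_heads[OF assms] by simp
  then have "count (image_mset fst P) x \<le> 1" for x
    unfolding P(2) bal using count_mset_le_1_of_distinct[of "map key_head C"] by simp
  moreover have "P \<noteq> {#}" using P(2) C(2) by auto
  ultimately show thesis using that P by (simp add: cycle_weight_eq_total_weight)
qed

text \<open>A cycle visits \<open>x\<close> at most once, so there are at least as many cycles as
  visits to \<open>x\<close>.\<close>

lemma balanced_passes_eq_cycles:
  assumes "balanced_passes P"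
  obtains Cs where "\<forall>C \<in> set Cs. key.cycle C"
    "total_weight pass_weight P = (\<lambda>u. \<Sum>C\<leftarrow>Cs. cycle_weight C u)"
    "\<And>x. count (image_mset fst P) x \<le> length Cs"
proof -
  obtain M where M: "set_mset M \<subseteq> arcs G" "image_mset key_tail M = image_mset key_head M"
    "image_mset key_tail M = image_mset fst P" "total_weight arc_weight M = total_weight pass_weight P"
    using balanced_arcs_of_passes[OF assms] by blast
  obtain Cs where Cs: "\<forall>C \<in> set Cs. key.cycle C" "M = (\<Sum>C\<leftarrow>Cs. mset C)"
    using key.balanced_eq_sum_cycles[of M] M by auto
  have "(\<lambda>u. \<Sum>C\<leftarrow>Ds. cycle_weight C u) = total_weight arc_weight (\<Sum>C\<leftarrow>Ds. mset C)" for Ds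
    by (induction Ds) (auto simp: fun_eq_iff cycle_weight_eq_total_weight total_weight_def)
  then have "total_weight pass_weight P = (\<lambda>u. \<Sum>C\<leftarrow>Cs. cycle_weight C u)"
    using Cs(2) M(4) by simp
  moreover have "count (image_mset key_head (\<Sum>C\<leftarrow>Ds. mset C)) x \<le> length Ds"
    if "\<forall>C \<in> set Ds. key.cycle C" for Ds x
    using that
  proof (induction Ds)
    case (Cons C Ds)
    then have "distinct (map key_head C)" using key.cycle_distinct_heads[of C] by simp
    then have "count (mset (map key_head C)) x \<le> 1"
      by (rule count_mset_le_1_of_distinct)
    with Cons show ?case by force
  qed simp
  then have "count (image_mset fst P) x \<le> length Cs" for x
    using Cs M by metis
  ultimately show thesis using that Cs(1) by blast
qed

section \<open>Functionals determined by the weight of a closed walk\<close>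

text \<open>Telescoping along a closed walk: \<open>g\<close> is a potential on the vertices of the pass graph.\<close>

lemma evaluate_balanced:
  assumes "balanced_passes P"
    and "\<And>p. p \<in># P \<Longrightarrow>
      evaluate n c q (pass_weight p) = g (pass_head p) - g (pass_tail p) + h p"
  shows "evaluate n c q (total_weight pass_weight P) = (\<Sum>p\<in>#P. h p)"
proof -
  have "(\<Sum>v\<in>#image_mset pass_head P. g v) = (\<Sum>v\<in>#image_mset pass_tail P. g v)"
    using assms(1) by (simp only: balanced_passes_def)
  then have "(\<Sum>p\<in>#P. g (pass_head p)) = (\<Sum>p\<in>#P. g (pass_tail p))"
    by (simp add: image_mset.compositionality comp_def)
  moreover have "evaluate n c q (total_weight pass_weight P) =
      (\<Sum>p\<in>#P. g (pass_head p) - g (pass_tail p) + h p)"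
    unfolding evaluate_total_weight by (intro arg_cong[of _ _ sum_mset] image_mset_cong assms(2))
  moreover have "\<dots> = (\<Sum>p\<in>#P. g (pass_head p)) - (\<Sum>p\<in>#P. g (pass_tail p)) + (\<Sum>p\<in>#P. h p)"
    by (induction P) auto
  ultimately show ?thesis by simp
qed

text \<open>A straight pass of either colour contributes 1, a turn from red to blue 2 and a turn
  from blue to red 0. The potential marking blue vertices evens out the turns.\<close>

lemma evaluate_size:
  assumes "balanced_passes P"
  shows "evaluate n 2 (\<lambda>_. -1) (total_weight pass_weight P) = int (size P)"
proof -
  have "evaluate n 2 (\<lambda>_. -1) (total_weight pass_weight P) = (\<Sum>p\<in>#P. 1)"
  proof (rule evaluate_balanced[OF assms, where g = "\<lambda>v. of_bool (fst v)"])
    fix p assume "p \<in># P"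
    moreover obtain x i j where "p = (x, i, j)" by (cases p)
    moreover from calculation have "x \<in> {1..n}" using assms by (auto simp: balanced_passes_def)
    ultimately show "evaluate n 2 (\<lambda>_. -1) (pass_weight p) =
        of_bool (fst (pass_head p)) - of_bool (fst (pass_tail p)) + 1"
      by (simp add: evaluate_pass_weight del: pass_weight.simps)
  qed
  then show ?thesis by simp
qed

text \<open>All arcs come from slack zero pairs, so the lengths \<open>r x - l x\<close> satisfy the
  inequality of every closed walk with equality.\<close>

lemma evaluate_canonical:
  assumes "balanced_passes P"
  shows "evaluate n 1 (\<lambda>x. r x - l x) (total_weight pass_weight P) = 0"
proof -
  have "evaluate n 1 (\<lambda>x. r x - l x) (total_weight pass_weight P) = (\<Sum>p\<in>#P. 0)"
  proof (rule evaluate_balanced[OF assms, where g = "\<lambda>v. snd v + of_bool (fst v)"])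
    fix p assume "p \<in># P"
    moreover obtain x i j where "p = (x, i, j)" by (cases p)
    moreover from calculation have "x \<in> {1..n}" using assms by (auto simp: balanced_passes_def)
    ultimately show "evaluate n 1 (\<lambda>x. r x - l x) (pass_weight p) =
        (snd (pass_head p) + of_bool (fst (pass_head p))) -
        (snd (pass_tail p) + of_bool (fst (pass_tail p))) + 0"
      by (simp add: evaluate_pass_weight del: pass_weight.simps)
  qed
  then show ?thesis by simp
qed

text \<open>The number of red arcs of a closed walk at the endpoint \<open>p\<close> depends only on its weight.\<close>

definition red_count :: "int \<Rightarrow> lin_ineq \<Rightarrow> int" where
  "red_count p = evaluate n 0 (\<lambda>x. - of_bool (l x \<le> p \<and> p \<le> r x))"

lemma red_count_eq:
  assumes "balanced_passes P"
  shows "red_count p (total_weight pass_weight P) = int (count (image_mset pass_head P) (False, p))"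
proof -
  have "red_count p (total_weight pass_weight P) = (\<Sum>q\<in>#P. of_bool (pass_head q = (False, p)))"
    unfolding red_count_def
  \<comment> \<open>A blue-blue pass goes from \<open>l x - 1\<close> up to \<open>r x\<close> and
    crosses \<open>p\<close> iff \<open>p\<close> lies in the interval. A red-red pass goes from
    \<open>r x\<close> down to \<open>l x\<close>; when it stops exactly at \<open>p = l x\<close>,
    the counted red arc makes up for the missing crossing.\<close>
  proof (rule evaluate_balanced[OF assms, where g = "\<lambda>v. of_bool (snd v < p)"])
    fix q assume "q \<in># P"
    moreover obtain x i j where "q = (x, i, j)" by (cases q)
    moreover from calculation have x: "x \<in> {1..n}" using assms by (auto simp: balanced_passes_def)
    moreover have "l x \<le> r x" using rep x by (auto simp: interval_rep_def)
    ultimately show "evaluate n 0 (\<lambda>x. - of_bool (l x \<le> p \<and> p \<le> r x)) (pass_weight q) =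
        of_bool (snd (pass_head q) < p) - of_bool (snd (pass_tail q) < p) +
        of_bool (pass_head q = (False, p))"
      by (auto simp: evaluate_pass_weight simp del: pass_weight.simps)
  qed
  moreover have "(\<Sum>q\<in>#P. of_bool (pass_head q = (False, p))) =
      int (count (image_mset pass_head P) (False, p))"
    by (induction P) auto
  ultimately show ?thesis by simp
qed

definition left_turns :: "pass multiset \<Rightarrow> int \<Rightarrow> nat" where
  "left_turns P p = (\<Sum>x | x \<in> {1..n} \<and> l x = p. count P (x, True, False))"

definition right_turns :: "pass multiset \<Rightarrow> int \<Rightarrow> nat" where
  "right_turns P p = (\<Sum>x | x \<in> {1..n} \<and> r x = p. count P (x, False, True))"

text \<open>Red arcs at \<open>p\<close> leave vertices with left endpoint \<open>p\<close>; they
  are sorted by the colour of the arc before them.\<close>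

lemma red_count_left:
  assumes "balanced_passes P"
  shows "red_count p (total_weight pass_weight P) = int
    (left_turns P p + (\<Sum>x | x \<in> {1..n} \<and> l x = p. count P (x, False, False)))"
proof -
  let ?X = "{x \<in> {1..n}. l x = p}" and ?f = "\<lambda>(x, i). (x, i, False)"
  have "count (image_mset pass_head P) (False, p) = (\<Sum>q\<in>?f ` (?X \<times> UNIV). count P q)"
    by (rule count_image_mset_eq_sum)
      (use assms in \<open>auto simp: balanced_passes_def image_iff split: if_splits\<close>)
  also have "\<dots> = (\<Sum>(x, i)\<in>?X \<times> UNIV. count P (x, i, False))"
    by (subst sum.reindex) (auto simp: inj_on_def intro!: sum.cong)
  also have "\<dots> = (\<Sum>x\<in>?X. count P (x, True, False) + count P (x, False, False))"
    by (simp add: sum.cartesian_product[symmetric] UNIV_bool add.commute)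
  finally show ?thesis by (simp add: red_count_eq[OF assms] sum.distrib left_turns_def)
qed

text \<open>The same red arcs enter vertices with right endpoint \<open>p\<close>; now they are
  sorted by the colour of the arc after them.\<close>

lemma red_count_right:
  assumes "balanced_passes P"
  shows "red_count p (total_weight pass_weight P) = int
    (right_turns P p + (\<Sum>x | x \<in> {1..n} \<and> r x = p. count P (x, False, False)))"
proof -
  let ?X = "{x \<in> {1..n}. r x = p}" and ?f = "\<lambda>(x, j). (x, False, j)"
  have "count (image_mset pass_tail P) (False, p) = (\<Sum>q\<in>?f ` (?X \<times> UNIV). count P q)"
    by (rule count_image_mset_eq_sum)
      (use assms in \<open>auto simp: balanced_passes_def image_iff split: if_splits\<close>)
  also have "\<dots> = (\<Sum>(x, j)\<in>?X \<times> UNIV. count P (x, False, j))"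
    by (subst sum.reindex) (auto simp: inj_on_def intro!: sum.cong)
  also have "\<dots> = (\<Sum>x\<in>?X. count P (x, False, True) + count P (x, False, False))"
    by (simp add: sum.cartesian_product[symmetric] UNIV_bool add.commute)
  finally show ?thesis
    using assms by (simp add: red_count_eq[OF assms] sum.distrib right_turns_def balanced_passes_def)
qed

section \<open>Integral redundancy\<close>

definition integrally_redundant :: "lin_ineq \<Rightarrow> bool" where
  "integrally_redundant W \<longleftrightarrow>
     (\<exists>(t::nat) (Ws :: nat \<Rightarrow> lin_ineq) (k :: nat \<Rightarrow> int).
        (\<forall>i\<in>{1..t}. cycle_ineq n prec l r (Ws i) \<and> \<not> lin_equivalent (Ws i) W \<and> 0 \<le> k i) \<and>
        (\<forall>u. W u = (\<Sum>i=1..t. k i * Ws i u)))"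

lemma evaluate_cycle_pos:
  assumes "key.cycle C"
  shows "0 < evaluate n 2 (\<lambda>_. -1) (cycle_weight C)"
proof -
  obtain P where "balanced_passes P" "P \<noteq> {#}" "total_weight pass_weight P = cycle_weight C"
    using cycle_passes[OF assms] by blast
  then show ?thesis using evaluate_size[of P] by (simp add: nonempty_has_size)
qed

text \<open>The arc-counting functional is positive on every cycle, so with at least two summands
  each one has a smaller value than \<open>W\<close> and cannot equal it.\<close>

lemma integrally_redundant_of_cycles:
  assumes "\<forall>C \<in> set Cs. key.cycle C" "2 \<le> length Cs"
    and W: "W = (\<lambda>u. \<Sum>C\<leftarrow>Cs. cycle_weight C u)"
  shows "integrally_redundant W"
proof -
  let ?h = "evaluate n 2 (\<lambda>_. -1)"
  let ?Ws = "\<lambda>i. cycle_weight (Cs ! (i - 1))"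
  have "?h (cycle_weight (Cs ! i)) < ?h W" if i: "i < length Cs" for i
  proof -
    obtain As Bs where split: "Cs = As @ Cs ! i # Bs" using id_take_nth_drop[OF i] by blast
    then have "As @ Bs \<noteq> []"
      using assms(2)
      by (metis append_Nil append_is_Nil_conv length_Cons list.size(3) Suc_1 Suc_n_not_le_n
          One_nat_def)
    moreover have pos: "0 < ?h (cycle_weight C)" if "C \<in> set (As @ Bs)" for C
      using that assms(1) split by (intro evaluate_cycle_pos)
        (metis Un_iff list.set_intros(2) set_append)
    moreover have "0 < (\<Sum>C\<leftarrow>Ds. ?h (cycle_weight C))"
      if "Ds \<noteq> []" "\<And>C. C \<in> set Ds \<Longrightarrow> 0 < ?h (cycle_weight C)" for Ds
      using that by (induction Ds rule: list_nonempty_induct) (auto intro!: add_pos_pos)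
    ultimately have "0 < (\<Sum>C\<leftarrow>As @ Bs. ?h (cycle_weight C))" by blast
    moreover have "?h W = (\<Sum>C\<leftarrow>As @ Bs. ?h (cycle_weight C)) + ?h (cycle_weight (Cs ! i))"
      unfolding W evaluate_sum_list by (subst split) simp
    ultimately show ?thesis by simp
  qed
  then have "?Ws i \<noteq> W" if "i \<in> {1..length Cs}" for i
    using that by (metis One_nat_def Suc_le_eq Suc_pred atLeastAtMost_iff less_irrefl)
  moreover have "cycle_ineq n prec l r (?Ws i)" if "i \<in> {1..length Cs}" for i
    using that assms(1) by (fastforce simp: cycle_ineq_def)
  moreover have "W u = (\<Sum>i=1..length Cs. 1 * ?Ws i u)" for u
    unfolding W sum_list_sum_nth length_map
    by (simp add: sum.atLeast1_atMost_eq atLeast0LessThan)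
  ultimately show ?thesis
    unfolding integrally_redundant_def lin_equivalent_def
    by (intro exI[of _ "length Cs"] exI[of _ ?Ws] exI[of _ "\<lambda>_. 1"]) simp
qed

lemma integrally_redundant_of_revisit:
  assumes "balanced_passes P" "2 \<le> count (image_mset fst P) x"
  shows "integrally_redundant (total_weight pass_weight P)"
proof -
  obtain Cs where "\<forall>C \<in> set Cs. key.cycle C"
    "total_weight pass_weight P = (\<lambda>u. \<Sum>C\<leftarrow>Cs. cycle_weight C u)"
    "\<And>x. count (image_mset fst P) x \<le> length Cs"
    using balanced_passes_eq_cycles[OF assms(1)] by blast
  with assms(2) show ?thesis
    by (intro integrally_redundant_of_cycles[of Cs]) (auto intro: order_trans)
qed

lemma integrally_redundant_of_split:
  assumes "balanced_passes P" "balanced_passes Q" "P \<noteq> {#}" "Q \<noteq> {#}"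
  shows "integrally_redundant (total_weight pass_weight (P + Q))"
proof -
  have *: "\<exists>Cs. Cs \<noteq> [] \<and> (\<forall>C \<in> set Cs. key.cycle C) \<and>
      total_weight pass_weight P = (\<lambda>u. \<Sum>C\<leftarrow>Cs. cycle_weight C u)"
    if P: "balanced_passes P" "P \<noteq> {#}" for P
  proof -
    obtain Cs where Cs: "\<forall>C \<in> set Cs. key.cycle C"
      "total_weight pass_weight P = (\<lambda>u. \<Sum>C\<leftarrow>Cs. cycle_weight C u)"
      "\<And>x. count (image_mset fst P) x \<le> length Cs"
      using balanced_passes_eq_cycles[OF P(1)] by blast
    obtain p where "p \<in># P" using P(2) by blast
    then have "0 < count (image_mset fst P) (fst p)" by simp
    with Cs show ?thesis by (metis le_zero_eq list.size(3) not_gr_zero)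
  qed
  obtain Cs Ds where CD: "Cs \<noteq> []" "Ds \<noteq> []" "\<forall>C \<in> set (Cs @ Ds). key.cycle C"
    "total_weight pass_weight P = (\<lambda>u. \<Sum>C\<leftarrow>Cs. cycle_weight C u)"
    "total_weight pass_weight Q = (\<lambda>u. \<Sum>C\<leftarrow>Ds. cycle_weight C u)"
    using *[of P] *[of Q] assms by auto
  have "total_weight pass_weight (P + Q) =
      (\<lambda>u. total_weight pass_weight P u + total_weight pass_weight Q u)"
    by (simp add: total_weight_def)
  then have "total_weight pass_weight (P + Q) = (\<lambda>u. \<Sum>C\<leftarrow>Cs @ Ds. cycle_weight C u)"
    by (simp add: CD(4,5))
  moreover have "2 \<le> length (Cs @ Ds)"
    using CD(1,2) by (cases Cs; cases Ds) auto
  ultimately show ?thesis using CD(3) integrally_redundant_of_cycles by blast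
qed

text \<open>The two turns have together the same tails and heads in the pass graph as a blue-blue
  and a red-red pass at \<open>x\<close>. Both pairs weigh \<open>One\<close>, since the terms in
  \<open>Rho x\<close> cancel.\<close>

lemma integrally_redundant_of_turns:
  assumes "balanced_passes P" "x \<in> {1..n}"
    and "(y, True, False) \<in># P" "l y = l x" "(z, False, True) \<in># P" "r z = r x"
  shows "integrally_redundant (total_weight pass_weight P)"
proof -
  obtain R' where R': "P = add_mset (y, True, False) R'"
    using assms(3) by (meson multi_member_split)
  with assms(5) obtain R where "R' = add_mset (z, False, True) R"
    by (metis insert_noteq_member multi_member_split prod.inject)
  with R' have P: "P = R + {#(y, True, False), (z, False, True)#}" by simp
  \<comment> \<open>Exchange the heads of the two turns; the new walk visits \<open>x\<close> twice.\<close>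
  let ?Q = "R + {#(x, True, True), (x, False, False)#}"
  have "balanced_passes ?Q"
    using assms(1,2,4,6) by (simp add: P balanced_passes_def add_mset_commute)
  moreover have "2 \<le> count (image_mset fst ?Q) x" by simp
  moreover have "total_weight pass_weight ?Q = total_weight pass_weight P"
    by (simp add: P total_weight_def in_weight_def out_weight_def)
  ultimately show ?thesis using integrally_redundant_of_revisit by metis
qed

text \<open>If all these coefficients vanished, \<open>evaluate_canonical\<close> would force the
  constant term to be 0, and then \<open>evaluate_size\<close> would give an empty walk.\<close>

lemma Rho_nonzero:
  assumes "balanced_passes P" "P \<noteq> {#}"
  obtains x where "x \<in> {1..n}" "total_weight pass_weight P (Rho x) \<noteq> 0"
proof -
  have False if "\<forall>x\<in>{1..n}. total_weight pass_weight P (Rho x) = 0"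
  proof -
    have "total_weight pass_weight P One = 0"
      using evaluate_canonical[OF assms(1)] that by (simp add: evaluate_def)
    then have "int (size P) = 0"
      unfolding evaluate_size[OF assms(1), symmetric] using that by (simp add: evaluate_def)
    with assms(2) show False by simp
  qed
  with that show thesis by blast
qed

text \<open>The cycles of \<open>Q\<close> in the pass graph repeat no pass, so each of them lies in
  \<open>P\<close> with multiplicity. One with a weight other than that of \<open>P\<close> leaves a
  non-empty balanced remainder.\<close>

lemma integrally_redundant_of_subcycle:
  assumes "balanced_passes P" "balanced_passes Q" "Q \<noteq> {#}" "set_mset Q \<subseteq> set_mset P"
    and "\<And>x. \<bar>total_weight pass_weight Q (Rho x)\<bar> \<le> 1"
    and "total_weight pass_weight Q \<noteq> total_weight pass_weight P"
  shows "integrally_redundant (total_weight pass_weight P)"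
proof -
  have "set_mset Q \<subseteq> arcs pass_graph"
    "image_mset (tail pass_graph) Q = image_mset (head pass_graph) Q"
    using assms(2) by (auto simp: balanced_passes_def)
  then obtain Zs where Zs: "\<forall>Z \<in> set Zs. pass.cycle Z" "Q = (\<Sum>Z\<leftarrow>Zs. mset Z)"
    using pass.balanced_eq_sum_cycles by blast
  have cyc: "balanced_passes (mset Z)" "mset Z \<noteq> {#}" "mset Z \<subseteq># P" if "Z \<in> set Zs" for Z
  proof -
    have Z: "pass.cycle Z" using Zs(1) that by blast
    then show "balanced_passes (mset Z)"
      using pass.cycle_balanced[OF Z]
      by (auto simp: balanced_passes_def pass.cycle_def pass.awalk_def)
    show "mset Z \<noteq> {#}" using Z by (auto simp: pass.cycle_def)
    have "distinct Z" using pass.cycle_distinct_heads[OF Z] by (simp add: distinct_map)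
    moreover have "mset Z \<subseteq># Q"
      unfolding Zs(2) using that by (metis member_le_sum_list_mset)
    ultimately show "mset Z \<subseteq># P"
      using assms(4) set_mset_mono[of "mset Z" Q] by (intro mset_subset_eq_of_distinct) auto
  qed
  show ?thesis
  proof (cases "\<exists>Z \<in> set Zs. total_weight pass_weight (mset Z) \<noteq> total_weight pass_weight P")
    case True
    then obtain Z where Z: "Z \<in> set Zs"
      "total_weight pass_weight (mset Z) \<noteq> total_weight pass_weight P" by blast
    let ?R = "P - mset Z"
    have P: "P = mset Z + ?R" using cyc(3)[OF Z(1)] by simp
    then have "?R \<noteq> {#}" using Z(2) by auto
    moreover have "balanced_passes ?R"
      using assms(1) cyc(1,3)[OF Z(1)]
      by (auto simp: balanced_passes_def image_mset_Diff dest: in_diffD)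
    ultimately show ?thesis
      using integrally_redundant_of_split[of "mset Z" ?R] cyc(1,2)[OF Z(1)] P by simp
  next
    \<comment> \<open>Otherwise the weight of \<open>Q\<close> is a positive multiple of that of
      \<open>P\<close>; the coefficient bound makes the factor 1, against the last
      assumption.\<close>
    case False
    have "total_weight pass_weight (\<Sum>Z\<leftarrow>Ys. mset Z) =
        (\<lambda>u. int (length Ys) * total_weight pass_weight P u)"
      if "set Ys \<subseteq> set Zs" for Ys
      using that
    proof (induction Ys)
      case (Cons Y Ys)
      have "total_weight pass_weight (mset Y + (\<Sum>Z\<leftarrow>Ys. mset Z)) =
          (\<lambda>u. total_weight pass_weight (mset Y) u + total_weight pass_weight (\<Sum>Z\<leftarrow>Ys. mset Z) u)"
        by (simp add: total_weight_def)
      with Cons False show ?case by (auto simp: algebra_simps)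
    qed (simp add: total_weight_def)
    then have Q: "total_weight pass_weight Q = (\<lambda>u. int (length Zs) * total_weight pass_weight P u)"
      using Zs(2) by simp
    obtain x where x: "total_weight pass_weight Q (Rho x) \<noteq> 0"
      using Rho_nonzero[OF assms(2,3)] by blast
    then have "int (length Zs) \<noteq> 0" "1 \<le> \<bar>total_weight pass_weight P (Rho x)\<bar>" by (auto simp: Q)
    then have "int (length Zs) * 1 \<le> int (length Zs) * \<bar>total_weight pass_weight P (Rho x)\<bar>"
      by (intro mult_left_mono) auto
    also have "\<dots> \<le> 1" using assms(5)[of x] by (simp add: Q abs_mult)
    finally have "length Zs = 1" using \<open>int (length Zs) \<noteq> 0\<close> by linarith
    with Q assms(6) show ?thesis by simp
  qed
qed

lemma left_turns_pos_iff:
  "0 < left_turns P p \<longleftrightarrow> (\<exists>x \<in> {1..n}. l x = p \<and> (x, True, False) \<in># P)"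
  unfolding left_turns_def neq0_conv[symmetric] by (subst sum_eq_0_iff) auto

lemma right_turns_pos_iff:
  "0 < right_turns P p \<longleftrightarrow> (\<exists>x \<in> {1..n}. r x = p \<and> (x, False, True) \<in># P)"
  unfolding right_turns_def neq0_conv[symmetric] by (subst sum_eq_0_iff) auto

section \<open>From rational to integral combinations\<close>

theorem redundant_imp_integrally_redundant:
  assumes "cycle_ineq n prec l r W" "redundant n prec l r W"
  shows "integrally_redundant W"
proof -
  obtain C where "key.cycle C" "W = cycle_weight C"
    using assms(1) by (auto simp: cycle_ineq_def)
  then obtain P0 where P0: "balanced_passes P0" "P0 \<noteq> {#}"
    "\<And>x. count (image_mset fst P0) x \<le> 1" "total_weight pass_weight P0 = W"
    using cycle_passes by metis
  obtain t Ws and \<alpha> :: "nat \<Rightarrow> rat" where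
    Ws: "\<And>i. i \<in> {1..t} \<Longrightarrow> cycle_ineq n prec l r (Ws i)"
      "\<And>i. i \<in> {1..t} \<Longrightarrow> Ws i \<noteq> W" and
    \<alpha>: "\<And>i. i \<in> {1..t} \<Longrightarrow> 0 \<le> \<alpha> i" and
    W_eq: "\<And>u. of_int (W u) = (\<Sum>i\<in>{1..t}. \<alpha> i * of_int (Ws i u))"
    using assms(2) unfolding redundant_def lin_equivalent_def by metis
  have "\<exists>P. balanced_passes P \<and> P \<noteq> {#} \<and> (\<forall>x. count (image_mset fst P) x \<le> 1) \<and>
      total_weight pass_weight P = Ws i" if "i \<in> {1..t}" for i
    using Ws(1)[OF that] cycle_passes unfolding cycle_ineq_def by metis
  then obtain P where P: "\<And>i. i \<in> {1..t} \<Longrightarrow> balanced_passes (P i)"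
    "\<And>i. i \<in> {1..t} \<Longrightarrow> P i \<noteq> {#}"
    "\<And>i x. i \<in> {1..t} \<Longrightarrow> count (image_mset fst (P i)) x \<le> 1"
    "\<And>i. i \<in> {1..t} \<Longrightarrow> total_weight pass_weight (P i) = Ws i"
    by metis
  define comb :: "(pass multiset \<Rightarrow> nat) \<Rightarrow> rat" where
    "comb f = (\<Sum>i\<in>{1..t}. \<alpha> i * of_nat (f (P i)))" for f
  have comb_ge: "\<alpha> i * of_nat (f (P i)) \<le> comb f" if "i \<in> {1..t}" for f i
    unfolding comb_def by (rule member_le_sum) (use that \<alpha> in auto)
  have comb_nonneg: "0 \<le> comb f" for f
    unfolding comb_def by (intro sum_nonneg) (use \<alpha> in auto)
  have comb_pos: "0 < comb f" if "i \<in> {1..t}" "0 < \<alpha> i" "0 < f (P i)" for f i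
    using that by (intro less_le_trans[OF _ comb_ge[OF that(1)]]) simp
  let ?up = "\<lambda>x P. count P (x, True, True)" and ?dn = "\<lambda>x P. count P (x, False, False)"
  have Rho: "of_nat (?up x P0) - of_nat (?dn x P0) = comb (?up x) - comb (?dn x)" for x
  proof -
    have "of_int (W (Rho x)) = comb (?up x) - comb (?dn x)"
      unfolding W_eq comb_def sum_subtractf[symmetric]
      by (intro sum.cong) (simp_all add: total_weight_pass_Rho algebra_simps flip: P(4))
    then show ?thesis by (simp add: total_weight_pass_Rho flip: P0(4))
  qed
  \<comment> \<open>A cycle with a red-red pass at \<open>x\<close> has no blue-blue pass there, so
    the coefficient of \<open>Rho x\<close> in \<open>W\<close> is negative and the combination
    needs at least as many red-red passes.\<close>
  have dn_le: "of_nat (?dn x P0) \<le> comb (?dn x)" for x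
  proof (cases "?dn x P0 = 0")
    case False
    then have "?up x P0 = 0" using count_image_fst_ge[of P0 x] P0(3)[of x] by linarith
    with Rho[of x] comb_nonneg[of "?up x"] show ?thesis by simp
  qed (simp add: comb_nonneg)
  have red: "of_int (red_count p W) =
      (\<Sum>i\<in>{1..t}. \<alpha> i * of_int (red_count p (total_weight pass_weight (P i))))" for p
    unfolding red_count_def by (rule evaluate_rat_combination) (simp add: W_eq P(4))
  \<comment> \<open>Both sides of the combination have the same number of red arcs at
    \<open>l x\<close>, so surplus red-red passes of the \<open>P i\<close> are matched by
    blue-to-red turns of \<open>P0\<close>.\<close>
  have left: "comb (\<lambda>P. left_turns P (l x)) + (comb (?dn x) - of_nat (?dn x P0)) \<le>
      of_nat (left_turns P0 (l x))"
    if "x \<in> {1..n}" for x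
    unfolding comb_def
  proof (rule turn_bound[where X = "{y \<in> {1..n}. l y = l x}" and c = "\<lambda>y. ?dn y P0"])
    have "of_int (red_count (l x) W) = (\<Sum>i = 1..t. \<alpha> i *
        of_nat (left_turns (P i) (l x) + (\<Sum>y | y \<in> {1..n} \<and> l y = l x. ?dn y (P i))))"
      unfolding red by (intro sum.cong) (simp_all add: red_count_left[OF P(1)])
    then show "of_nat (left_turns P0 (l x) + (\<Sum>y | y \<in> {1..n} \<and> l y = l x. ?dn y P0)) =
        (\<Sum>i = 1..t. \<alpha> i *
          of_nat (left_turns (P i) (l x) + (\<Sum>y | y \<in> {1..n} \<and> l y = l x. ?dn y (P i))))"
      unfolding P0(4)[symmetric] red_count_left[OF P0(1)] of_int_of_nat_eq .
  qed (use that dn_le in \<open>auto simp: comb_def\<close>)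
  have right: "comb (\<lambda>P. right_turns P (r x)) + (comb (?dn x) - of_nat (?dn x P0)) \<le>
      of_nat (right_turns P0 (r x))"
    if "x \<in> {1..n}" for x
    unfolding comb_def
  proof (rule turn_bound[where X = "{y \<in> {1..n}. r y = r x}" and c = "\<lambda>y. ?dn y P0"])
    have "of_int (red_count (r x) W) = (\<Sum>i = 1..t. \<alpha> i *
        of_nat (right_turns (P i) (r x) + (\<Sum>y | y \<in> {1..n} \<and> r y = r x. ?dn y (P i))))"
      unfolding red by (intro sum.cong) (simp_all add: red_count_right[OF P(1)])
    then show "of_nat (right_turns P0 (r x) + (\<Sum>y | y \<in> {1..n} \<and> r y = r x. ?dn y P0)) =
        (\<Sum>i = 1..t. \<alpha> i *
          of_nat (right_turns (P i) (r x) + (\<Sum>y | y \<in> {1..n} \<and> r y = r x. ?dn y (P i))))"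
      unfolding P0(4)[symmetric] red_count_right[OF P0(1)] of_int_of_nat_eq .
  qed (use that dn_le in \<open>auto simp: comb_def\<close>)
  show ?thesis
  proof (cases "\<exists>x\<in>{1..n}. of_nat (?dn x P0) < comb (?dn x)")
    case True
    then obtain x where x: "x \<in> {1..n}" "of_nat (?dn x P0) < comb (?dn x)" by blast
    \<comment> \<open>Terms in \<open>Rho x\<close> cancel in the sum, and the strict surplus forces
      turns at both endpoints of \<open>x\<close>.\<close>
    have "0 < left_turns P0 (l x)" "0 < right_turns P0 (r x)"
      using left[OF x(1)] right[OF x(1)] x(2) comb_nonneg[of "\<lambda>P. left_turns P (l x)"]
        comb_nonneg[of "\<lambda>P. right_turns P (r x)"]
      by (auto intro!: gr0I)
    then obtain y z where "(y, True, False) \<in># P0" "l y = l x"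
      "(z, False, True) \<in># P0" "r z = r x"
      unfolding left_turns_pos_iff right_turns_pos_iff by blast
    then show ?thesis
      using integrally_redundant_of_turns[OF P0(1) x(1)] unfolding P0(4) by blast
  next
    case False
    have dn: "comb (?dn x) = of_nat (?dn x P0)" if "x \<in> {1..n}" for x
    proof (rule order.antisym)
      show "comb (?dn x) \<le> of_nat (?dn x P0)" by (rule leI) (use False that in blast)
    qed (rule dn_le)
    then have up: "comb (?up x) = of_nat (?up x P0)" if "x \<in> {1..n}" for x
      using Rho[of x] that by simp
    \<comment> \<open>A non-zero coefficient of \<open>W\<close> guarantees an index with positive
      \<open>\<alpha> i\<close>.\<close>
    obtain y where "total_weight pass_weight P0 (Rho y) \<noteq> 0"
      by (rule Rho_nonzero[OF P0(1,2)])
    then have "(\<Sum>i\<in>{1..t}. \<alpha> i * of_int (Ws i (Rho y))) \<noteq> 0"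
      unfolding P0(4) W_eq[symmetric] by simp
    then obtain i where "i \<in> {1..t}" "\<alpha> i * of_int (Ws i (Rho y)) \<noteq> 0"
      by (rule sum.not_neutral_contains_not_neutral)
    with \<alpha> have i: "i \<in> {1..t}" "0 < \<alpha> i"
      by (auto simp: order.strict_iff_order)
    \<comment> \<open>A straight pass of \<open>P i\<close> occurs in \<open>P0\<close> itself. A
      turn may occur at another vertex with the same endpoint, but the weight of a turn does not
      depend on the vertex.\<close>
    have "\<exists>q' \<in># P0. pass_tail q' = pass_tail q \<and> pass_head q' = pass_head q \<and>
        pass_weight q' = pass_weight q" if q: "q \<in># P i" for q
    proof -
      obtain x b c where xbc: "q = (x, b, c)" by (cases q)
      have x: "x \<in> {1..n}" using P(1)[OF i(1)] q xbc by (auto simp: balanced_passes_def)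
      consider "b" "c" | "\<not> b" "\<not> c" | "b" "\<not> c" | "\<not> b" "c" by blast
      then show ?thesis
      proof cases
        case 1
        then have "0 < comb (?up x)" using q xbc by (intro comb_pos[OF i]) simp
        then have "q \<in># P0" using up[OF x] xbc 1 by simp
        then show ?thesis by blast
      next
        case 2
        then have "0 < comb (?dn x)" using q xbc by (intro comb_pos[OF i]) simp
        then have "q \<in># P0" using dn[OF x] xbc 2 by simp
        then show ?thesis by blast
      next
        case 3
        then have "0 < left_turns (P i) (l x)" using q xbc x left_turns_pos_iff by auto
        then have "0 < comb (\<lambda>P. left_turns P (l x))" by (rule comb_pos[OF i])
        with left[OF x] dn[OF x] have "0 < left_turns P0 (l x)" by (auto intro!: gr0I)
        then obtain y where "l y = l x" "(y, True, False) \<in># P0" using left_turns_pos_iff by auto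
        with 3 xbc show ?thesis
          by (intro bexI[of _ "(y, True, False)"]) (auto simp: in_weight_def out_weight_def)
      next
        case 4
        then have "0 < right_turns (P i) (r x)" using q xbc x right_turns_pos_iff by auto
        then have "0 < comb (\<lambda>P. right_turns P (r x))" by (rule comb_pos[OF i])
        with right[OF x] dn[OF x] have "0 < right_turns P0 (r x)" by (auto intro!: gr0I)
        then obtain y where "r y = r x" "(y, False, True) \<in># P0" using right_turns_pos_iff by auto
        with 4 xbc show ?thesis
          by (intro bexI[of _ "(y, False, True)"]) (auto simp: in_weight_def out_weight_def)
      qed
    qed
    then obtain \<sigma> where \<sigma>: "\<And>q. q \<in># P i \<Longrightarrow> \<sigma> q \<in># P0"
      "\<And>q. q \<in># P i \<Longrightarrow> pass_tail (\<sigma> q) = pass_tail q"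
      "\<And>q. q \<in># P i \<Longrightarrow> pass_head (\<sigma> q) = pass_head q"
      "\<And>q. q \<in># P i \<Longrightarrow> pass_weight (\<sigma> q) = pass_weight q"
      by metis
    let ?Q = "image_mset \<sigma> (P i)"
    have "image_mset pass_tail ?Q = image_mset pass_tail (P i)"
      "image_mset pass_head ?Q = image_mset pass_head (P i)"
      unfolding image_mset.compositionality by (intro image_mset_cong; simp add: \<sigma>)+
    moreover have sub: "set_mset ?Q \<subseteq> set_mset P0" using \<sigma>(1) by auto
    ultimately have "balanced_passes ?Q"
      using P(1)[OF i(1)] P0(1) by (auto simp: balanced_passes_def)
    moreover have Q: "total_weight pass_weight ?Q = Ws i"
      unfolding P(4)[OF i(1), symmetric] total_weight_def image_mset.compositionality
      by (intro ext arg_cong[of _ _ sum_mset] image_mset_cong) (simp add: \<sigma>)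
    \<comment> \<open>The substitution may merge visits to different vertices, so the bound is taken
      from \<open>P i\<close>, which has the same weight and visits each vertex at most
      once.\<close>
    moreover have "\<bar>total_weight pass_weight ?Q (Rho x)\<bar> \<le> 1" for x
      using count_image_fst_ge[of "P i" x] P(3)[OF i(1), of x]
      unfolding Q P(4)[OF i(1), symmetric] total_weight_pass_Rho by linarith
    ultimately show ?thesis
      using integrally_redundant_of_subcycle[OF P0(1), of ?Q] sub P(2)[OF i(1)] Ws(2)[OF i(1)] P0(4)
      by simp
  qed
qed

end

theorem theorem5p1:
  fixes n :: nat
    and prec :: "nat \<Rightarrow> nat \<Rightarrow> bool"
    and l r :: "nat \<Rightarrow> int"
    and W :: lin_ineq
  assumes "interval_order n prec"
    and "canonical_rep n prec l r"
    and "cycle_ineq n prec l r W"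
    and "redundant n prec l r W"
  shows "\<exists>(t::nat) (Ws :: nat \<Rightarrow> lin_ineq) (k :: nat \<Rightarrow> int).
           (\<forall>i\<in>{1..t}. cycle_ineq n prec l r (Ws i) \<and> \<not> lin_equivalent (Ws i) W \<and> 0 \<le> k i) \<and>
           (\<forall>u. W u = (\<Sum>i=1..t. k i * Ws i u))"
proof -
  interpret interval_representation n prec l r
    using assms(2) by unfold_locales (simp add: canonical_rep_def)
  show ?thesis
    using redundant_imp_integrally_redundant[OF assms(3,4)] by (simp add: integrally_redundant_def)
qed

end
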